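(* Let $d\ge 1$ be an integer, let $\mu>0$, and let $\underline{\underline{E}} = (d\mu)^{-1} I$, where $I$ is the $d\times d$ identity matrix. Let $\varpi:\mathbb{R}^d\to[0,\infty)$ be a symmetric, infinitely divisible probability density, with Fourier transform $\tilde{\varpi}(\vec{k}) = \int_{\mathbb{R}^d} e^{\imath \vec{k}\cdot\vec{x}}\varpi(\vec{x})\,d\vec{x}$. Assume that $\tilde{\varpi}(\vec{k})$ depends only on the Euclidean length $|\vec{k}|$, and that $$\tilde{\varpi}(\vec{k})^t = \tilde{\varpi}\bigl(t^{\underline{\underline{E}}^{T}}\vec{k}\bigr)\qquad\text{for all } t>0 \text{ and all } \vec{k}\in\mathbb{R}^d .$$ Then for all $\vec{k}\in\mathbb{R}^d$ $$\tilde{\varpi}(\vec{k}) = \exp\left(\mathcal{C}\,|\vec{k}|^{d\mu}\right),\qquad \mathcal{C} := \log \tilde{\varpi}(1),$$ where $\tilde{\varpi}(1)$ denotes the common value of $\tilde{\varpi}$ on the unit sphere $\{|\vec{k}|=1\}$.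
   Context: For a real $d\times d$ matrix $A$ and $t>0$, $t^{A} := \exp(A\log t)$; thus for $\underline{\underline{E}}=(d\mu)^{-1}I$ one has $t^{\underline{\underline{E}}^{T}}\vec{k} = t^{1/(d\mu)}\vec{k}$. $\underline{\underline{E}}^{T}$ is the transpose of $\underline{\underline{E}}$. Symmetric means $\varpi(-\vec{x})=\varpi(\vec{x})$. Infinitely divisible means that for every $n\in\mathbb{N}$ the probability measure with density $\varpi$ is the $n$-fold convolution power of some probability measure. For such $\varpi$ the function $\tilde{\varpi}$ is real-valued and strictly positive, and $\tilde{\varpi}(\vec{k})^t$ is the usual real power of a positive number. *)

theory Defs
  imports "HOL-Probability.Probability"
begin

text \<open>Probability densities on \<open>\<real>\<^sup>d\<close> are taken with respect to Lebesgue measure and are Borel measurable.\<close>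

definition prob_density :: "('a::euclidean_space \<Rightarrow> real) \<Rightarrow> bool" where
  "prob_density w \<longleftrightarrow>
     w \<in> borel_measurable borel \<and> (\<forall>x. 0 \<le> w x) \<and> prob_space (density lborel (\<lambda>x. ennreal (w x)))"

primrec convolution_power :: "'a::ordered_euclidean_space measure \<Rightarrow> nat \<Rightarrow> 'a measure" where
  "convolution_power N 0 = return borel 0"
| "convolution_power N (Suc n) = convolution N (convolution_power N n)"

definition infinitely_divisible :: "'a::ordered_euclidean_space measure \<Rightarrow> bool" where
  "infinitely_divisible M \<longleftrightarrow>
     (\<forall>n\<ge>1. \<exists>N. prob_space N \<and> sets N = sets borel \<and> M = convolution_power N n)"

definition fourier :: "('a::euclidean_space \<Rightarrow> real) \<Rightarrow> 'a \<Rightarrow> complex" where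
  "fourier w k = (LINT x|lborel. exp (\<i> * complex_of_real (k \<bullet> x)) * complex_of_real (w x))"

text \<open>Multiplication, and hence \<open>^\<close>, on the type of square matrices is componentwise in the
  library, so the matrix exponential series is written with the matrix product \<open>**\<close>.\<close>

primrec matrix_power :: "real^'n^'n \<Rightarrow> nat \<Rightarrow> real^'n^'n" where
  "matrix_power A 0 = mat 1"
| "matrix_power A (Suc n) = A ** matrix_power A n"

definition matrix_exp :: "real^'n^'n \<Rightarrow> real^'n^'n" where
  "matrix_exp A = (\<Sum>n. inverse (fact n) *\<^sub>R matrix_power A n)"

definition powr_matrix :: "real \<Rightarrow> real^'n^'n \<Rightarrow> real^'n^'n" where
  "powr_matrix t A = matrix_exp (ln t *\<^sub>R A)"

definition radial :: "('a::real_normed_vector \<Rightarrow> 'b) \<Rightarrow> bool" where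
  "radial f \<longleftrightarrow> (\<forall>x y. norm x = norm y \<longrightarrow> f x = f y)"

text \<open>Meaningful for radial \<open>f\<close> on a nonzero space.\<close>

definition unit_sphere_value :: "('a::real_normed_vector \<Rightarrow> 'b) \<Rightarrow> 'b" where
  "unit_sphere_value f = (THE c. \<forall>u. norm u = 1 \<longrightarrow> f u = c)"

end

theory Submission
  imports Defs
begin

text \<open>Scaling a unit vector to length \<open>r\<close> is the action of \<open>t\<close> with \<open>t = r powr (d\<mu>)\<close>, so the scaling
  relation fixes the transform on each ray from its value on the sphere. That value is nonnegative
  by the case \<open>t = 1\<close>, and nonzero because a zero would propagate along the ray to the origin, where
  the transform is continuous with value \<open>1\<close>. Radiality gives invariance under \<open>k \<mapsto> - k\<close>, which
  conjugates the transform, so it is real.\<close>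

lemma matrix_power_scaled_mat_1: "matrix_power (a *\<^sub>R mat 1) n = a ^ n *\<^sub>R (mat 1 :: real^'n^'n)"
  by (induction n) (simp_all add: matrix_scalar_ac scalar_matrix_assoc[symmetric])

text \<open>Powers of a multiple of the identity stay multiples of it, so the series is the scalar
  exponential series times \<open>mat 1\<close>.\<close>

lemma matrix_exp_scaled_mat_1: "matrix_exp (a *\<^sub>R mat 1) = exp a *\<^sub>R (mat 1 :: real^'n^'n)"
proof -
  have "(\<lambda>n. (a ^ n /\<^sub>R fact n) *\<^sub>R (mat 1 :: real^'n^'n)) sums (exp a *\<^sub>R mat 1)"
    by (intro sums_scaleR_left exp_converges)
  then show ?thesis
    unfolding matrix_exp_def matrix_power_scaled_mat_1 by (simp add: sums_iff)
qed

lemma powr_matrix_scaled_mat_1_mult: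
  assumes "t > 0"
  shows "powr_matrix t (a *\<^sub>R mat 1) *v (k :: real^'n) = t powr a *\<^sub>R k"
  using assms
  by (simp add: powr_matrix_def matrix_exp_scaled_mat_1 powr_def mult.commute
      scaleR_matrix_vector_assoc[symmetric])

lemma prob_density_integral:
  fixes w :: "'a::euclidean_space \<Rightarrow> real"
  assumes "prob_density w"
  shows "integrable lborel w" and "integral\<^sup>L lborel w = 1"
proof -
  have w: "w \<in> borel_measurable borel" "\<And>x. 0 \<le> w x"
    using assms by (auto simp: prob_density_def)
  interpret prob_space "density lborel (\<lambda>x. ennreal (w x))"
    using assms by (simp add: prob_density_def)
  have "(\<integral>\<^sup>+x. ennreal (w x) \<partial>lborel) = 1"
    using emeasure_space_1 w by (simp add: emeasure_density)
  then show "integrable lborel w" and "integral\<^sup>L lborel w = 1"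
    using w by (auto intro!: integrableI_nn_integral_finite[where x = 1] simp: integral_eq_nn_integral)
qed

lemma fourier_0:
  assumes "prob_density w"
  shows "fourier w 0 = 1"
  using prob_density_integral[OF assms] by (simp add: fourier_def)

text \<open>As \<open>w\<close> is real-valued, conjugation only flips the sign in the
  exponent.\<close>

lemma cnj_fourier: "cnj (fourier w k) = fourier w (- k)"
  unfolding fourier_def
  by (subst Bochner_Integration.integral_cnj[symmetric]) (simp add: exp_cnj del: Bochner_Integration.integral_cnj)

text \<open>Dominated convergence with \<open>w\<close> itself as the bound, since the exponential
  factor has modulus one.\<close>

lemma fourier_tendsto_0:
  fixes w :: "'a::euclidean_space \<Rightarrow> real"
  assumes "prob_density w"
    and "f \<longlonglongrightarrow> 0"
  shows "(\<lambda>n. fourier w (f n)) \<longlonglongrightarrow> 1"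
proof -
  have [measurable]: "w \<in> borel_measurable borel" and nonneg: "\<And>x. 0 \<le> w x"
    using assms(1) by (auto simp: prob_density_def)
  have "(\<lambda>n. fourier w (f n)) \<longlonglongrightarrow> fourier w 0"
    unfolding fourier_def
  proof (rule integral_dominated_convergence[where w = w])
    show "AE x in lborel. (\<lambda>n. exp (\<i> * complex_of_real (f n \<bullet> x)) * complex_of_real (w x))
        \<longlonglongrightarrow> exp (\<i> * complex_of_real (0 \<bullet> x)) * complex_of_real (w x)"
      by (intro always_eventually allI tendsto_intros assms(2))
  qed (use prob_density_integral[OF assms(1)] nonneg in \<open>auto simp: norm_mult\<close>)
  then show ?thesis
    by (simp add: fourier_0[OF assms(1)])
qed

text \<open>Radiality gives existence of the constant; the unit vector \<open>u\<close> gives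
  uniqueness, as the sphere is then nonempty.\<close>

lemma unit_sphere_value_eq:
  assumes "radial f" and "norm u = 1"
  shows "unit_sphere_value f = f u"
  unfolding unit_sphere_value_def
  by (rule the_equality) (use assms in \<open>metis radial_def\<close>)+

theorem mainTheorem1:
  fixes \<mu> C :: real
    and E :: "real^'n^'n"
    and w :: "real^'n \<Rightarrow> real"
  assumes "\<mu> > 0"
    and "E = inverse (real CARD('n) * \<mu>) *\<^sub>R mat 1"
    and "prob_density w"
    and "\<forall>x. w (- x) = w x"
    and "infinitely_divisible (density lborel (\<lambda>x. ennreal (w x)))"
    and "radial (fourier w)"
    and "\<forall>t>0. \<forall>k. Re (fourier w k) powr t = Re (fourier w (powr_matrix t (transpose E) *v k))"
    and "C = ln (Re (unit_sphere_value (fourier w)))"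
  shows "\<forall>k. fourier w k = complex_of_real (exp (C * norm k powr (real CARD('n) * \<mu>)))"
proof
  fix k :: "real^'n"
  define a where "a = real CARD('n) * \<mu>"
  have a: "a > 0"
    using assms(1) by (simp add: a_def)
  have "transpose E = inverse a *\<^sub>R mat 1"
    by (simp add: assms(2) a_def transpose_scalar)
  then have scale: "Re (fourier w v) powr t = Re (fourier w (t powr inverse a *\<^sub>R v))"
    if "t > 0" for t v
    using assms(7) that by (simp add: powr_matrix_scaled_mat_1_mult)
  have scale': "Re (fourier w (r *\<^sub>R v)) = Re (fourier w v) powr (r powr a)" if "r > 0" for r v
    using scale[of "r powr a" v] a that by (simp add: powr_powr)
  have "fourier w (- k) = fourier w k"
    using assms(6) unfolding radial_def by (metis norm_minus_cancel)
  then have "cnj (fourier w k) = fourier w k"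
    by (simp add: cnj_fourier)
  then have real: "fourier w k = complex_of_real (Re (fourier w k))"
    by (simp add: complex_eq_iff)
  have pos: "Re (fourier w v) > 0" for v
  proof -
    have "Re (fourier w v) \<noteq> 0"
    proof
      assume "Re (fourier w v) = 0"
      \<comment> \<open>Since \<open>0 powr s = 0\<close> for every \<open>s\<close>, the zero
        passes to points arbitrarily near the origin.\<close>
      then have zero: "Re (fourier w (inverse (real (Suc n)) *\<^sub>R v)) = 0" for n
        by (subst scale') simp_all
      have "(\<lambda>n. inverse (real (Suc n)) *\<^sub>R v) \<longlonglongrightarrow> 0 *\<^sub>R v"
        by (intro tendsto_scaleR tendsto_const LIMSEQ_inverse_real_of_nat)
      then have "(\<lambda>n. Re (fourier w (inverse (real (Suc n)) *\<^sub>R v))) \<longlonglongrightarrow> Re 1"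
        by (intro tendsto_Re fourier_tendsto_0 assms(3)) simp
      then show False
        unfolding zero by (simp add: LIMSEQ_const_iff)
    qed
    \<comment> \<open>A real \<open>powr\<close> is nonnegative whatever the sign of its base, so
      nothing about the sign is presupposed.\<close>
    moreover have "Re (fourier w v) \<ge> 0"
      using scale[of 1 v] powr_ge_zero[of "Re (fourier w v)" 1] by simp
    ultimately show ?thesis
      by simp
  qed
  show "fourier w k = complex_of_real (exp (C * norm k powr (real CARD('n) * \<mu>)))"
  \<comment> \<open>The origin has no direction to normalise; there both sides are 1, because
    \<open>0 powr a = 0\<close>.\<close>
  proof (cases "k = 0")
    case True
    then show ?thesis
      using a by (simp add: fourier_0[OF assms(3)])
  next
    case False
    define u where "u = inverse (norm k) *\<^sub>R k"
    have u: "norm u = 1" "norm k *\<^sub>R u = k"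
      using False by (simp_all add: u_def)
    have "C = ln (Re (fourier w u))"
      using assms(8) unit_sphere_value_eq[OF assms(6) u(1)] by simp
    moreover have "Re (fourier w k) = Re (fourier w u) powr (norm k powr a)"
      using scale'[of "norm k" u] False u(2) by simp
    \<comment> \<open>\<open>powr\<close> unfolds to \<open>exp\<close> of a multiple of
      \<open>ln\<close> only for a nonzero base, which \<open>pos\<close> supplies.\<close>
    ultimately have "Re (fourier w k) = exp (C * norm k powr a)"
      using pos[of u] by (simp add: powr_def[of "Re (fourier w u)"] mult.commute)
    then show ?thesis
      by (subst real) (simp add: a_def)
  qed
qed

end
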